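(* Let $\mathbf X$ be an unkilled Borel right Markov process with locally compact separable state space $\mathcal X$, transition semigroup $(P_t)_{t\ge 0}$ and resolvent $(U_\lambda)_{\lambda>0}$. Suppose that $\mathcal H$ is a set of bounded nonnegative measurable functions on $\mathcal X$ such that $P_t\mathcal H\subset\mathcal H$ for every $t\ge 0$, and that there are a non-trivial measure $\chi$ on $(\mathcal X,\mathcal B(\mathcal X))$ and a family $(\alpha_\lambda)_{\lambda>0}$ of finite measures on $(\mathcal X,\mathcal B(\mathcal X))$ with $\lim_{\lambda\downarrow 0}\alpha_\lambda(\mathcal X)=0$ such that for every $f\in\mathcal H$ $$\lim_{\lambda\downarrow 0}\int_{\mathcal X}U_\lambda f(x)\,\alpha_\lambda(dx)=\chi(f):=\int_{\mathcal X}f(y)\,\chi(dy).$$ Then for every $t\ge 0$ and $f\in\mathcal H$, $$\int_{\mathcal X}P_tf(y)\,\chi(dy)=\chi(f).$$ In particular, if $\mathcal H$ is the set of all bounded nonnegative measurable functions on $\mathcal X$ (and $\chi$ is $\sigma$-finite), then $\chi$ is an invariant measure of $\mathbf X$.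
   Context: $P_tf(x)=\mathbb E^x[f(X_t)]$ and $U_\lambda f(x)=\int_0^\infty e^{-\lambda t}P_tf(x)\,dt$. Unkilled means that the lifetime is a.s. infinite. Borel right processes are in the sense of Sharpe's "General Theory of Markov Processes". A $\sigma$-finite measure $\chi$ is invariant for $\mathbf X$ if $\int_{\mathcal X}\mathbb P^x(X_t\in B)\,\chi(dx)=\chi(B)$ for all $t\ge 0$ and $B\in\mathcal B(\mathcal X)$. *)

theory Defs
  imports "HOL-Probability.Probability"
begin

text \<open>
  Adjunction of a cemetery: \<^term>\<open>None\<close> is an isolated point of \<^typ>\<open>'a option\<close>, and
  \<^term>\<open>Some\<close> embeds \<^typ>\<open>'a\<close> as an open and closed subspace.
\<close>

instantiation option :: (topological_space) topological_space
begin

definition open_option :: "'a option set \<Rightarrow> bool"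
  where "open_option U \<longleftrightarrow> open (Some -` U)"

instance
proof
  show "open (UNIV :: 'a option set)"
    by (simp add: open_option_def)
  show "open (S \<inter> T)" if "open S" "open T" for S T :: "'a option set"
    using that by (simp add: open_option_def open_Int)
  show "open (\<Union>K)" if "\<forall>S\<in>K. open S" for K :: "'a option set set"
    using that by (auto simp: open_option_def vimage_Union)
qed

end

text \<open>
  A Lusin topological space is one that is homeomorphic to a Borel subset of a compact metrizable
  space \<open>K\<close>. Compact metrizable spaces have at most continuum many points, so it is no restriction
  to let \<open>K\<close> be a topology on a set of reals (unrelated to the usual topology of the reals).
\<close>

definition lusin_space :: "'a topology \<Rightarrow> bool"
  where "lusin_space T \<longleftrightarrow>
    (\<exists>(K :: real topology) B. compact_space K \<and> metrizable_space K \<and>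
       B \<in> sigma_sets (topspace K) {U. openin K U} \<and>
       T homeomorphic_space subtopology K B)"

definition univ_borel :: "'a::topological_space measure"
  where "univ_borel = sigma UNIV
    {A. \<forall>\<mu>. prob_space \<mu> \<and> sets \<mu> = sets borel \<longrightarrow> A \<in> sets (completion \<mu>)}"

text \<open>
  The law \<open>P\<^sup>\<mu> = \<integral> P\<^sup>x \<mu>(dx)\<close>. The completion is needed because \<open>x \<mapsto> P\<^sup>x(A)\<close> is only required to be
  universally measurable.
\<close>

definition law :: "('a \<Rightarrow> 'w measure) \<Rightarrow> 'a measure \<Rightarrow> 'w measure"
  where "law P \<mu> = completion \<mu> \<bind> P"

text \<open>
  The \<open>\<alpha>\<close>-excessive functions of \<open>P\<^sub>t f(x) = E\<^sup>x[f(X\<^sub>t)]\<close>. They need not be Borel, but are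
  universally measurable.
\<close>

definition excessive ::
  "('a::topological_space \<Rightarrow> 'w measure) \<Rightarrow> (real \<Rightarrow> 'w \<Rightarrow> 'a) \<Rightarrow> real \<Rightarrow> ('a \<Rightarrow> ennreal) \<Rightarrow> bool"
  where "excessive P X \<alpha> f \<longleftrightarrow>
    f \<in> borel_measurable univ_borel \<and>
    (\<forall>t\<ge>0. \<forall>x. ennreal (exp (- \<alpha> * t)) * (\<integral>\<^sup>+\<omega>. f (X t \<omega>) \<partial>P x) \<le> f x) \<and>
    (\<forall>x. ((\<lambda>t. ennreal (exp (- \<alpha> * t)) * (\<integral>\<^sup>+\<omega>. f (X t \<omega>) \<partial>P x)) \<longlongrightarrow> f x) (at_right 0))"

text \<open>
  Borel right processes in the sense of Sharpe, given by the sextuple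
  \<open>(\<Omega>, \<G>, \<G>\<^sub>t, X\<^sub>t, \<theta>\<^sub>t, P\<^sup>x)\<close>, where \<open>\<G>\<close> stands for the measurable space \<open>(\<Omega>, \<G>)\<close> (its measure is
  not used). Times are the reals \<open>t \<ge> 0\<close>; nothing is required at negative times.

  The process has no distinguished point here; cemetery and lifetime come with the next locale.
  A set belongs to \<open>\<G>\<^sub>t \<or> N\<^sup>\<mu>\<close>, with \<open>N\<^sup>\<mu>\<close> the \<open>P\<^sup>\<mu>\<close>-null sets, iff it differs from a member
  of \<open>\<G>\<^sub>t\<close> by a \<open>P\<^sup>\<mu>\<close>-null set; this is how augmentation is written below.
\<close>

locale borel_right_process =
  fixes \<G> :: "'w measure"
    and F :: "real \<Rightarrow> 'w measure"
    and X :: "real \<Rightarrow> 'w \<Rightarrow> 'a::topological_space"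
    and \<theta> :: "real \<Rightarrow> 'w \<Rightarrow> 'w"
    and P :: "'a \<Rightarrow> 'w measure"
  assumes lusin: "lusin_space (euclidean :: 'a topology)"
    and subalgebra_F: "t \<ge> 0 \<Longrightarrow> subalgebra \<G> (F t)"
    and right_continuous_F: "t \<ge> 0 \<Longrightarrow> sets (F t) = (\<Inter>s\<in>{t<..}. sets (F s))"
    and complete_\<G>: "A \<subseteq> space \<G> \<Longrightarrow>
      (\<And>\<mu>. prob_space \<mu> \<Longrightarrow> sets \<mu> = sets borel \<Longrightarrow> A \<in> sets (completion (law P \<mu>))) \<Longrightarrow>
      A \<in> sets \<G>"
    and augmented_F: "t \<ge> 0 \<Longrightarrow> A \<subseteq> space \<G> \<Longrightarrow>
      (\<And>\<mu>. prob_space \<mu> \<Longrightarrow> sets \<mu> = sets borel \<Longrightarrow>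
        \<exists>B\<in>sets (F t). \<exists>N\<in>null_sets (law P \<mu>). (A - B) \<union> (B - A) \<subseteq> N) \<Longrightarrow>
      A \<in> sets (F t)"
    and adapted: "t \<ge> 0 \<Longrightarrow> X t \<in> measurable (F t) borel"
    and right_continuous_paths: "\<omega> \<in> space \<G> \<Longrightarrow> t \<ge> 0 \<Longrightarrow>
      ((\<lambda>s. X s \<omega>) \<longlongrightarrow> X t \<omega>) (at_right t)"
    and shift_closed: "t \<ge> 0 \<Longrightarrow> \<omega> \<in> space \<G> \<Longrightarrow> \<theta> t \<omega> \<in> space \<G>"
    and shift: "s \<ge> 0 \<Longrightarrow> t \<ge> 0 \<Longrightarrow> \<omega> \<in> space \<G> \<Longrightarrow> X s (\<theta> t \<omega>) = X (s + t) \<omega>"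
    and kernel: "P \<in> measurable univ_borel (prob_algebra \<G>)"
    and normal: "AE \<omega> in P x. X 0 \<omega> = x"
    and Markov: "prob_space \<mu> \<Longrightarrow> sets \<mu> = sets borel \<Longrightarrow> s \<ge> 0 \<Longrightarrow> t \<ge> 0 \<Longrightarrow>
      (f :: 'a \<Rightarrow> real) \<in> borel_measurable borel \<Longrightarrow> bounded (range f) \<Longrightarrow>
      AE \<omega> in law P \<mu>. real_cond_exp (law P \<mu>) (F t) (\<lambda>\<omega>. f (X (t + s) \<omega>)) \<omega>
        = (\<integral>\<omega>'. f (X s \<omega>') \<partial>P (X t \<omega>))"
    and excessive_right_continuous:
      "\<alpha> > 0 \<Longrightarrow> excessive P X \<alpha> g \<Longrightarrow> prob_space \<mu> \<Longrightarrow> sets \<mu> = sets borel \<Longrightarrow>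
      AE \<omega> in law P \<mu>. \<forall>t\<ge>0. ((\<lambda>s. g (X s \<omega>)) \<longlongrightarrow> g (X t \<omega>)) (at_right t)"
    and Borel_semigroup: "t \<ge> 0 \<Longrightarrow>
      (f :: 'a \<Rightarrow> real) \<in> borel_measurable borel \<Longrightarrow> bounded (range f) \<Longrightarrow>
      (\<lambda>x. \<integral>\<omega>. f (X t \<omega>) \<partial>P x) \<in> borel_measurable borel"

text \<open>
  A Borel right process with state space \<^typ>\<open>'a\<close> and possibly finite lifetime is a Borel right
  process on \<^typ>\<open>'a option\<close> for which the cemetery \<^term>\<open>None\<close> is a trap. The state space
  \<^typ>\<open>'a\<close> is Lusin iff \<^typ>\<open>'a option\<close> is.
\<close>

locale borel_right_process_with_lifetime = borel_right_process \<G> F X \<theta> P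
  for \<G> :: "'w measure"
    and F :: "real \<Rightarrow> 'w measure"
    and X :: "real \<Rightarrow> 'w \<Rightarrow> 'a::topological_space option"
    and \<theta> :: "real \<Rightarrow> 'w \<Rightarrow> 'w"
    and P :: "'a option \<Rightarrow> 'w measure" +
  assumes trap: "\<omega> \<in> space \<G> \<Longrightarrow> 0 \<le> s \<Longrightarrow> s \<le> t \<Longrightarrow> X s \<omega> = None \<Longrightarrow> X t \<omega> = None"

definition lifetime :: "(real \<Rightarrow> 'w \<Rightarrow> 'a option) \<Rightarrow> 'w \<Rightarrow> ereal"
  where "lifetime X \<omega> = Inf {ereal t |t. 0 \<le> t \<and> X t \<omega> = None}"

definition unkilled :: "('a option \<Rightarrow> 'w measure) \<Rightarrow> (real \<Rightarrow> 'w \<Rightarrow> 'a option) \<Rightarrow> bool"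
  where "unkilled P X \<longleftrightarrow> (\<forall>x. AE \<omega> in P (Some x). lifetime X \<omega> = \<infinity>)"

text \<open>Functions on the state space are extended by \<open>0\<close> to the cemetery.\<close>

definition trans_op ::
  "('a option \<Rightarrow> 'w measure) \<Rightarrow> (real \<Rightarrow> 'w \<Rightarrow> 'a option) \<Rightarrow> real \<Rightarrow> ('a \<Rightarrow> real) \<Rightarrow> 'a \<Rightarrow> real"
  where "trans_op P X t f x = (\<integral>\<omega>. case_option 0 f (X t \<omega>) \<partial>P (Some x))"

definition resolvent_op ::
  "('a option \<Rightarrow> 'w measure) \<Rightarrow> (real \<Rightarrow> 'w \<Rightarrow> 'a option) \<Rightarrow> real \<Rightarrow> ('a \<Rightarrow> real) \<Rightarrow> 'a \<Rightarrow> real"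
  where "resolvent_op P X l f x = (LBINT t:{0..}. exp (- l * t) * trans_op P X t f x)"

definition bounded_nonneg_borel :: "('a::topological_space \<Rightarrow> real) set"
  where "bounded_nonneg_borel =
    {f. f \<in> borel_measurable borel \<and> (\<forall>x. 0 \<le> f x) \<and> bounded (range f)}"

definition invariant_measure ::
  "('a::topological_space option \<Rightarrow> 'w measure) \<Rightarrow> (real \<Rightarrow> 'w \<Rightarrow> 'a option) \<Rightarrow> 'a measure \<Rightarrow> bool"
  where "invariant_measure P X chi \<longleftrightarrow>
    sets chi = sets borel \<and> sigma_finite_measure chi \<and>
    (\<forall>t\<ge>0. \<forall>B\<in>sets borel.
      (\<integral>\<^sup>+x. emeasure (P (Some x)) {\<omega> \<in> space (P (Some x)). X t \<omega> \<in> Some ` B} \<partial>chi)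
        = emeasure chi B)"

end

theory Submission
  imports Defs
begin

text \<open>
  The resolvent integrates the semigroup over all times, so replacing \<open>f\<close> by \<open>P\<^sub>t f\<close> only removes
  a time window of length \<open>t\<close>: substituting \<open>u = s + t\<close> in the semigroup law gives
  \<open>e\<^bsup>\<lambda>t\<^esup> U\<^sub>\<lambda> f = e\<^bsup>\<lambda>t\<^esup> R\<^sub>\<lambda> + U\<^sub>\<lambda> (P\<^sub>t f)\<close>, where \<open>R\<^sub>\<lambda>\<close> is the integral of \<open>e\<^bsup>-\<lambda>u\<^esup> P\<^sub>u f\<close> over
  \<open>[0, t)\<close> and hence lies between \<open>0\<close> and \<open>t sup f\<close> (\<open>resolvent_op_shift\<close>,
  \<open>discounted_integral_le\<close>). Integrating against \<open>\<alpha>\<^sub>\<lambda>\<close> and letting \<open>\<lambda>\<close> decrease to \<open>0\<close>, the left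
  side tends to \<open>\<chi>(f)\<close>, the last summand to \<open>\<chi>(P\<^sub>t f)\<close>, and the middle one to \<open>0\<close> because its
  size is at most a constant times the mass of \<open>\<alpha>\<^sub>\<lambda>\<close> (\<open>limit_measure_trans_op\<close>). The identity is
  an equation between sums in \<open>[0, \<infinity>]\<close>, so it also covers \<open>\<chi>(f) = \<infinity>\<close>. Invariance is the case of
  indicator functions.

  Two facts about right processes support this. The semigroup law (\<open>Chapman_Kolmogorov\<close>) comes
  from the Markov property by taking expectations under a Dirac initial law. And \<open>(t, x) \<mapsto> P\<^sub>t f x\<close>
  must be jointly Borel, both for the time integrals to be meaningful and for the integration
  against \<open>\<alpha>\<^sub>\<lambda>\<close> to be additive. For continuous \<open>f\<close> this follows from right continuity of the paths,
  since \<open>P\<^sub>t f x\<close> is then a limit of functions that are piecewise constant in \<open>t\<close>; metrizability of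
  the state space extends it to indicators of open sets, and a generating-class argument to all
  Borel functions (\<open>transition_kernel_measurable\<close>).
\<close>

section \<open>Indicators of open sets and universal measurability\<close>

text \<open>
  In a metrizable space \<open>U\<close> is a union of an increasing sequence of closed sets; the function with
  index \<open>n\<close> separates the closed set with index \<open>n\<close> from the complement of \<open>U\<close>.
\<close>

lemma open_indicator_limit:
  fixes U :: "'a::topological_space set"
  assumes metr: "metrizable_space (euclidean :: 'a topology)" and U: "open U"
  obtains f :: "nat \<Rightarrow> 'a \<Rightarrow> real"
  where "\<And>n. continuous_on UNIV (f n)" "\<And>n x. f n x \<in> {0..1}"
    "\<And>x. (\<lambda>n. f n x) \<longlonglongrightarrow> indicator U x"
proof -
  have "fsigma_in euclidean U"
    using open_imp_fsigma_in[OF metr] U by simp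
  then obtain C where C: "\<And>n. closed (C n)" "incseq C" "\<Union> (range C) = U"
    unfolding fsigma_in_ascending by (metis closed_closedin incseq_SucI)
  have "\<exists>f. continuous_on UNIV f \<and> (\<forall>x. f x \<in> {0..1::real}) \<and> f ` (- U) \<subseteq> {0} \<and> f ` C n \<subseteq> {1}" for n
  proof -
    have "disjnt (- U) (C n)"
      using C(3) by (auto simp: disjnt_def)
    then obtain f where "continuous_map euclidean (top_of_set {0..1::real}) f"
        "f ` (- U) \<subseteq> {0}" "f ` C n \<subseteq> {1}"
      using Urysohn_lemma[OF metrizable_imp_normal_space[OF metr], of "- U" "C n" 0 1] U C(1)
      by (auto simp: closed_Compl)
    then show ?thesis
      by (auto simp: continuous_map_in_subtopology image_subset_iff Pi_iff)
  qed
  then obtain f where f: "\<And>n. continuous_on UNIV (f n)" "\<And>n x. f n x \<in> {0..1::real}"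
      "\<And>n. f n ` (- U) \<subseteq> {0}" "\<And>n. f n ` C n \<subseteq> {1}"
    by metis
  have "(\<lambda>n. f n x) \<longlonglongrightarrow> indicator U x" for x
  proof (cases "x \<in> U")
    case True
    then obtain m where "x \<in> C m"
      using C(3) by blast
    then have "f n x = 1" if "n \<ge> m" for n
      using incseqD[OF C(2) that] f(4)[of n] by blast
    with True show ?thesis
      by (auto intro!: tendsto_eventually eventually_sequentiallyI[of m])
  next
    case False
    then have "f n x = 0" for n
      using f(3)[of n] by blast
    with False show ?thesis by simp
  qed
  with f that show thesis by blast
qed

text \<open>
  This lets the kernel \<open>x \<mapsto> P\<^sup>x\<close>, which is only universally measurable, be integrated against
  the completion of an initial law.
\<close>

lemma measurable_completion_univ_borel:
  assumes \<mu>: "prob_space \<mu>" "sets \<mu> = sets borel" and f: "f \<in> measurable univ_borel N"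
  shows "f \<in> measurable (completion \<mu>) N"
proof -
  have sp: "space \<mu> = UNIV"
    using sets_eq_imp_space_eq[OF \<mu>(2)] by simp
  have "sets (univ_borel :: 'a measure) \<subseteq> sets (completion \<mu>)"
    unfolding univ_borel_def
    using sets.sigma_sets_subset[of "{A. \<forall>\<mu>. prob_space \<mu> \<and> sets \<mu> = sets borel \<longrightarrow> A \<in> sets (completion \<mu>)}" "completion \<mu>"] \<mu>
    by (auto simp: sp)
  moreover have "space (univ_borel :: 'a measure) = UNIV"
    by (simp add: univ_borel_def)
  ultimately show ?thesis
    using f by (auto simp: measurable_def sp)
qed

section \<open>Transition kernels of a Borel right process\<close>

context borel_right_process
begin

lemma metrizable: "metrizable_space (euclidean :: 'a topology)"
  using lusin unfolding lusin_space_def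
  by (metis homeomorphic_metrizable_space metrizable_space_subtopology)

lemma singleton_borel: "{x :: 'a} \<in> sets borel"
proof -
  have "closedin (euclidean :: 'a topology) {x}"
    using metrizable_imp_Hausdorff_space[OF metrizable] by (intro closedin_Hausdorff_sing_eq[THEN iffD2]) auto
  then show ?thesis
    by (intro borel_closed) simp
qed

lemma P_in_prob_algebra: "P x \<in> space (prob_algebra \<G>)"
  using measurable_space[OF kernel, of x] by (simp add: univ_borel_def)

lemma prob_space_P: "prob_space (P x)"
  and sets_P: "sets (P x) = sets \<G>"
  using P_in_prob_algebra[of x] by (auto simp: space_prob_algebra)

lemma space_P: "space (P x) = space \<G>"
  by (rule sets_eq_imp_space_eq[OF sets_P])

lemma X_measurable: "t \<ge> 0 \<Longrightarrow> X t \<in> measurable \<G> borel"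
  using measurable_from_subalg[OF subalgebra_F adapted] .

lemma X_measurable_P: "t \<ge> 0 \<Longrightarrow> X t \<in> measurable (P x) borel"
  using X_measurable by (simp cong: measurable_cong_sets add: measurable_cong_sets[OF sets_P refl])

text \<open>
  A Dirac measure sees only the point \<open>x\<close>, a Borel set by metrizability; so the Markov property,
  which is stated for initial laws, can be used under each \<open>P\<^sup>x\<close>.
\<close>

lemma law_return: "law P (return borel x) = P x"
proof (rule measure_eqI)
  let ?r = "return borel x :: 'a measure"
  have ps: "prob_space ?r"
    by (rule prob_space_return) simp
  have P: "P \<in> measurable (completion ?r) (subprob_algebra \<G>)"
    by (rule measurable_prob_algebraD[OF measurable_completion_univ_borel[OF ps _ kernel]]) simp
  show "sets (law P ?r) = sets (P x)"
    unfolding law_def by (subst sets_bind_measurable[OF P]) (auto simp: sets_P)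
  fix A assume "A \<in> sets (law P ?r)"
  then have A: "A \<in> sets \<G>"
    unfolding law_def by (subst (asm) sets_bind_measurable[OF P]) auto
  have ae: "AE y in completion ?r. y = x"
    unfolding AE_completion_iff
    using singleton_borel[of x] by (subst AE_return) (auto simp: pred_def)
  interpret r: prob_space "completion ?r"
    using ps by (simp add: prob_space.prob_space_completion)
  have "emeasure (law P ?r) A = (\<integral>\<^sup>+y. emeasure (P y) A \<partial>completion ?r)"
    unfolding law_def using A by (subst emeasure_bind[OF _ P]) auto
  also have "\<dots> = (\<integral>\<^sup>+y. emeasure (P x) A \<partial>completion ?r)"
    using ae by (intro nn_integral_cong_AE) auto
  also have "\<dots> = emeasure (P x) A"
    by (simp add: r.emeasure_space_1[simplified])
  finally show "emeasure (law P ?r) A = emeasure (P x) A" .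
qed

lemma integrable_bounded_X:
  fixes g :: "'a \<Rightarrow> real"
  assumes g: "g \<in> borel_measurable borel" "bounded (range g)" and t: "t \<ge> 0"
  shows "integrable (P x) (\<lambda>\<omega>. g (X t \<omega>))"
proof -
  interpret prob_space "P x" by (rule prob_space_P)
  obtain B where "\<And>y. norm (g y) \<le> B"
    using g(2) by (auto simp: bounded_iff)
  then show ?thesis
    using measurable_compose[OF X_measurable_P[OF t] g(1)]
    by (intro integrable_const_bound[of _ B]) auto
qed

text \<open>
  Freezing the time at the next point of the grid of mesh \<open>1 / (n + 1)\<close> leaves countably many times,
  each contributing a Borel function of the starting point. The grid points approach \<open>t\<close> strictly from
  the right, so right continuity of the paths and dominated convergence recover the expectation at
  time \<open>t\<close>. Truncating the time at \<open>0\<close> makes the function total, as nothing is known about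
  negative times.
\<close>

lemma expectation_X_measurable_continuous:
  fixes g :: "'a \<Rightarrow> real"
  assumes cont: "continuous_on UNIV g" and bdd: "bounded (range g)"
  shows "(\<lambda>z. \<integral>\<omega>. g (X (max 0 (fst z)) \<omega>) \<partial>P (snd z)) \<in> borel_measurable (borel \<Otimes>\<^sub>M borel)"
proof -
  have g: "g \<in> borel_measurable borel"
    using borel_measurable_continuous_onI[OF cont] .
  obtain B where B: "\<And>y. norm (g y) \<le> B"
    using bdd by (auto simp: bounded_iff)
  define d where "d n t = (real_of_int \<lfloor>real (Suc n) * max 0 t\<rfloor> + 1) / real (Suc n)" for n t
  have d_gt: "max 0 t < d n t" and d_le: "d n t \<le> max 0 t + 1 / real (Suc n)" for n t
  proof -
    have N: "real (Suc n) > 0" by simp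
    have "real (Suc n) * max 0 t < real_of_int \<lfloor>real (Suc n) * max 0 t\<rfloor> + 1"
        "real_of_int \<lfloor>real (Suc n) * max 0 t\<rfloor> \<le> real (Suc n) * max 0 t"
      by linarith+
    then show "max 0 t < d n t" "d n t \<le> max 0 t + 1 / real (Suc n)"
      unfolding d_def pos_less_divide_eq[OF N] pos_divide_le_eq[OF N] distrib_right
      using N by (simp_all add: mult.commute del: of_nat_Suc)
  qed
  have d_lim: "filterlim (\<lambda>n. d n t) (at_right (max 0 t)) sequentially" for t
  proof (rule tendsto_imp_filterlim_at_right)
    have "(\<lambda>n. max 0 t + 1 / real (Suc n)) \<longlonglongrightarrow> max 0 t + 0"
      by (intro tendsto_intros LIMSEQ_Suc[OF lim_1_over_n])
    then have upper: "(\<lambda>n. max 0 t + 1 / real (Suc n)) \<longlonglongrightarrow> max 0 t"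
      by (simp only: add_0_right)
    show "(\<lambda>n. d n t) \<longlonglongrightarrow> max 0 t"
      by (rule tendsto_sandwich[OF _ _ tendsto_const upper])
        (intro always_eventually allI less_imp_le[OF d_gt] d_le)+
    show "eventually (\<lambda>n. max 0 t < d n t) sequentially"
      by (intro always_eventually allI d_gt)
  qed
  show ?thesis
  proof (rule borel_measurable_LIMSEQ_real)
    fix z :: "real \<times> 'a"
    interpret prob_space "P (snd z)" by (rule prob_space_P)
    show "(\<lambda>n. \<integral>\<omega>. g (X (d n (fst z)) \<omega>) \<partial>P (snd z)) \<longlonglongrightarrow> (\<integral>\<omega>. g (X (max 0 (fst z)) \<omega>) \<partial>P (snd z))"
    proof (rule integral_dominated_convergence[where w="\<lambda>_. B"])
      have "0 \<le> d n (fst z)" for n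
        using d_gt[of "fst z" n] by simp
      then show "(\<lambda>\<omega>. g (X (d n (fst z)) \<omega>)) \<in> borel_measurable (P (snd z))" for n
        by (intro measurable_compose[OF X_measurable_P g])
      show "(\<lambda>\<omega>. g (X (max 0 (fst z)) \<omega>)) \<in> borel_measurable (P (snd z))"
        by (intro measurable_compose[OF X_measurable_P g]) simp
      show "AE \<omega> in P (snd z). (\<lambda>n. g (X (d n (fst z)) \<omega>)) \<longlonglongrightarrow> g (X (max 0 (fst z)) \<omega>)"
      proof (rule AE_I2)
        fix \<omega> assume "\<omega> \<in> space (P (snd z))"
        then have "((\<lambda>s. X s \<omega>) \<longlongrightarrow> X (max 0 (fst z)) \<omega>) (at_right (max 0 (fst z)))"
          by (intro right_continuous_paths) (auto simp: space_P)
        then have "(\<lambda>n. X (d n (fst z)) \<omega>) \<longlonglongrightarrow> X (max 0 (fst z)) \<omega>"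
          by (rule filterlim_compose[OF _ d_lim])
        then show "(\<lambda>n. g (X (d n (fst z)) \<omega>)) \<longlonglongrightarrow> g (X (max 0 (fst z)) \<omega>)"
          by (rule continuous_on_tendsto_compose[OF cont]) auto
      qed
    qed (use B in auto)
  next
    fix n
    have *: "(\<lambda>z. \<integral>\<omega>. g (X (max 0 ((real_of_int i + 1) / real (Suc n))) \<omega>) \<partial>P (snd z))
        \<in> borel_measurable (borel \<Otimes>\<^sub>M borel)" for i :: int
      by (rule measurable_compose[OF measurable_snd Borel_semigroup[OF _ g bdd]]) simp
    have "(\<lambda>z. \<integral>\<omega>. g (X (max 0 ((real_of_int \<lfloor>real (Suc n) * max 0 (fst z)\<rfloor> + 1) / real (Suc n))) \<omega>) \<partial>P (snd z))
        \<in> borel_measurable ((borel :: real measure) \<Otimes>\<^sub>M (borel :: 'a measure))"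
      by (rule measurable_compose_countable[OF *]) measurable
    moreover have "max 0 (d n t) = d n t" for t
      using d_gt[of t n] by simp
    ultimately show "(\<lambda>z. \<integral>\<omega>. g (X (d n (fst z)) \<omega>) \<partial>P (snd z)) \<in> borel_measurable (borel \<Otimes>\<^sub>M borel)"
      unfolding d_def by simp
  qed
qed

text \<open>
  Open sets form an intersection-stable generator, so it suffices to treat their indicators, which are
  pointwise limits of continuous functions.
\<close>

lemma transition_kernel_measurable:
  "(\<lambda>z. distr (P (snd z)) borel (X (max 0 (fst z)))) \<in> measurable (borel \<Otimes>\<^sub>M borel) (prob_algebra borel)"
proof (rule measurable_prob_algebra_generated[where \<Omega>=UNIV and G="{U. open U}"])
  show "sets (borel :: 'a measure) = sigma_sets UNIV {U. open U}"
    by (simp add: borel_def)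
  show "Int_stable {U :: 'a set. open U}"
    by (auto simp: Int_stable_def)
  show "prob_space (distr (P (snd z)) borel (X (max 0 (fst z))))" for z :: "real \<times> 'a"
    by (rule prob_space.prob_space_distr[OF prob_space_P X_measurable_P]) simp
  fix U :: "'a set" assume "U \<in> {U. open U}"
  then have U: "open U" by simp
  obtain f :: "nat \<Rightarrow> 'a \<Rightarrow> real" where f: "\<And>n. continuous_on UNIV (f n)" "\<And>n x. f n x \<in> {0..1}"
      "\<And>x. (\<lambda>n. f n x) \<longlonglongrightarrow> indicator U x"
    using open_indicator_limit[OF metrizable U] by blast
  have bdd: "bounded (range (f n))" for n
    using f(2)[of n] by (auto intro!: boundedI[of _ 1])
  have lim: "(\<lambda>n. \<integral>\<omega>. f n (X (max 0 (fst z)) \<omega>) \<partial>P (snd z)) \<longlonglongrightarrow>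
      measure (distr (P (snd z)) borel (X (max 0 (fst z)))) U" for z :: "real \<times> 'a"
  proof -
    interpret prob_space "P (snd z)" by (rule prob_space_P)
    have m: "X (max 0 (fst z)) \<in> measurable (P (snd z)) borel"
      by (rule X_measurable_P) simp
    have "(\<lambda>n. \<integral>\<omega>. f n (X (max 0 (fst z)) \<omega>) \<partial>P (snd z)) \<longlonglongrightarrow>
        (\<integral>\<omega>. indicator U (X (max 0 (fst z)) \<omega>) \<partial>P (snd z))"
    proof (rule integral_dominated_convergence[where w="\<lambda>_. 1"])
      show "(\<lambda>\<omega>. indicator U (X (max 0 (fst z)) \<omega>) :: real) \<in> borel_measurable (P (snd z))"
        using U by (intro measurable_compose[OF m]) simp
      show "(\<lambda>\<omega>. f n (X (max 0 (fst z)) \<omega>)) \<in> borel_measurable (P (snd z))" for n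
        by (intro measurable_compose[OF m] borel_measurable_continuous_onI f)
    qed (use f in auto)
    also have "(\<integral>\<omega>. indicator U (X (max 0 (fst z)) \<omega>) \<partial>P (snd z)) =
        (\<integral>y. indicat_real U y \<partial>distr (P (snd z)) borel (X (max 0 (fst z))))"
      using U by (intro integral_distr[OF m, symmetric]) simp
    finally show ?thesis by simp
  qed
  have "(\<lambda>z. measure (distr (P (snd z)) borel (X (max 0 (fst z)))) U) \<in> borel_measurable (borel \<Otimes>\<^sub>M borel)"
    by (rule borel_measurable_LIMSEQ_real[OF lim expectation_X_measurable_continuous[OF f(1) bdd]])
  moreover have "emeasure (distr (P (snd z)) borel (X (max 0 (fst z)))) U =
      ennreal (measure (distr (P (snd z)) borel (X (max 0 (fst z)))) U)" for z :: "real \<times> 'a"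
    by (intro finite_measure.emeasure_eq_measure prob_space.finite_measure
        prob_space.prob_space_distr[OF prob_space_P X_measurable_P]) simp
  ultimately show "(\<lambda>z. emeasure (distr (P (snd z)) borel (X (max 0 (fst z)))) U) \<in> borel_measurable (borel \<Otimes>\<^sub>M borel)"
    by simp
qed auto

lemma expectation_X_measurable:
  fixes g :: "'a \<Rightarrow> real"
  assumes g: "g \<in> borel_measurable borel"
  shows "(\<lambda>z. \<integral>\<omega>. g (X (max 0 (fst z)) \<omega>) \<partial>P (snd z)) \<in> borel_measurable (borel \<Otimes>\<^sub>M borel)"
proof -
  have "(\<lambda>z. \<integral>y. g y \<partial>distr (P (snd z)) borel (X (max 0 (fst z)))) \<in> borel_measurable (borel \<Otimes>\<^sub>M borel)"
    by (rule measurable_compose[OF measurable_prob_algebraD[OF transition_kernel_measurable]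
          integral_measurable_subprob_algebra[OF g]])
  then show ?thesis
    by (simp add: integral_distr[OF X_measurable_P g])
qed

lemma Chapman_Kolmogorov:
  fixes g :: "'a \<Rightarrow> real"
  assumes g: "g \<in> borel_measurable borel" "bounded (range g)" and st: "s \<ge> 0" "t \<ge> 0"
  shows "(\<integral>\<omega>. (\<integral>\<omega>'. g (X t \<omega>') \<partial>P (X s \<omega>)) \<partial>P x) = (\<integral>\<omega>. g (X (s + t) \<omega>) \<partial>P x)"
proof -
  interpret prob_space "P x" by (rule prob_space_P)
  have "subalgebra (P x) (F s)"
    using subalgebra_F[OF st(1)] by (simp add: subalgebra_def sets_P space_P)
  then interpret finite_measure_subalgebra "P x" "F s"
    by unfold_locales
  have "AE \<omega> in P x. real_cond_exp (P x) (F s) (\<lambda>\<omega>. g (X (s + t) \<omega>)) \<omega>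
      = (\<integral>\<omega>'. g (X t \<omega>') \<partial>P (X s \<omega>))"
    using Markov[OF prob_space_return, of x borel, OF _ _ st(2,1) g] unfolding law_return by simp
  then have "(\<integral>\<omega>. (\<integral>\<omega>'. g (X t \<omega>') \<partial>P (X s \<omega>)) \<partial>P x) =
      (\<integral>\<omega>. real_cond_exp (P x) (F s) (\<lambda>\<omega>. g (X (s + t) \<omega>)) \<omega> \<partial>P x)"
    using measurable_compose[OF X_measurable_P[OF st(1)] Borel_semigroup[OF st(2) g]]
    by (intro integral_cong_AE) auto
  also have "\<dots> = (\<integral>\<omega>. g (X (s + t) \<omega>) \<partial>P x)"
    using st by (intro real_cond_exp_int integrable_bounded_X g) simp
  finally show ?thesis .
qed

end


section \<open>Functions extended to the cemetery\<close>

text \<open>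
  As the cemetery is isolated, the retraction that sends it to an arbitrary point of the state space
  is continuous.
\<close>

lemma case_option_borel_measurable:
  fixes f :: "'a::topological_space \<Rightarrow> real"
  assumes "f \<in> borel_measurable borel"
  shows "case_option c f \<in> borel_measurable borel"
proof -
  define r :: "'a option \<Rightarrow> 'a" where "r = case_option undefined (\<lambda>x. x)"
  have "continuous_on UNIV r"
    by (auto simp: continuous_on_open_vimage open_option_def r_def vimage_def)
  then have r: "r \<in> measurable borel borel"
    by (rule borel_measurable_continuous_onI)
  have N: "{None :: 'a option} \<in> sets borel"
    by (intro borel_open) (simp add: open_option_def vimage_def)
  have "(\<lambda>y. if y \<in> {None} then c else f (r y)) \<in> borel_measurable borel"
    using measurable_compose[OF r assms] N by (intro measurable_If_set) auto
  also have "(\<lambda>y. if y \<in> {None} then c else f (r y)) = case_option c f"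
    by (auto simp: r_def split: option.split)
  finally show ?thesis .
qed

lemma bounded_case_option:
  "bounded (range f) \<Longrightarrow> bounded (range (case_option (c :: real) f))"
  by (rule bounded_subset[of "insert c (range f)"]) (auto split: option.splits)

lemma Some_borel_measurable: "Some \<in> measurable borel borel"
  by (rule borel_measurable_continuous_onI)
    (auto simp: continuous_on_open_vimage open_option_def)

section \<open>Semigroup and resolvent on the state space\<close>

text \<open>
  For \<open>A = {0..}\<close> this is the resolvent, but with values in \<open>[0, \<infinity>]\<close>, so that splitting the time
  axis and integrating in \<open>x\<close> need no integrability conditions.
\<close>

definition discounted_integral ::
  "('a option \<Rightarrow> 'w measure) \<Rightarrow> (real \<Rightarrow> 'w \<Rightarrow> 'a option) \<Rightarrow> real \<Rightarrow> real set \<Rightarrow> ('a \<Rightarrow> real) \<Rightarrow> 'a \<Rightarrow> ennreal"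
  where "discounted_integral P X l A f x =
    (\<integral>\<^sup>+u. ennreal (exp (- l * u) * trans_op P X u f x) * indicator A u \<partial>lborel)"

context borel_right_process_with_lifetime
begin

lemma trans_op_measurable:
  assumes "f \<in> borel_measurable borel"
  shows "(\<lambda>z. trans_op P X (max 0 (fst z)) f (snd z)) \<in> borel_measurable (borel \<Otimes>\<^sub>M borel)"
proof -
  have "(\<lambda>z. (fst z, Some (snd z))) \<in> measurable (borel \<Otimes>\<^sub>M borel :: (real \<times> 'a) measure) (borel \<Otimes>\<^sub>M borel)"
    using Some_borel_measurable by measurable
  from measurable_compose[OF this expectation_X_measurable[OF case_option_borel_measurable[OF assms, of 0]]]
  show ?thesis
    by (simp add: trans_op_def)
qed

text \<open>
  The extension of \<open>P\<^sub>t f\<close> by \<open>0\<close> equals \<open>y \<mapsto> E\<^sup>y[f(X\<^sub>t)]\<close> at the cemetery too, because the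
  cemetery is a trap and \<open>f\<close> vanishes there. So the law for the process on the
  enlarged space applies.
\<close>

lemma trans_op_semigroup:
  assumes f: "f \<in> bounded_nonneg_borel" and st: "s \<ge> 0" "t \<ge> 0"
  shows "trans_op P X s (trans_op P X t f) x = trans_op P X (s + t) f x"
proof -
  let ?g = "case_option 0 f"
  have g: "?g \<in> borel_measurable borel" "bounded (range ?g)"
    using f by (auto simp: bounded_nonneg_borel_def intro: case_option_borel_measurable bounded_case_option)
  have "AE \<omega> in P None. ?g (X t \<omega>) = 0"
    using normal[of None] AE_space
  proof eventually_elim
    case (elim \<omega>)
    then have "X t \<omega> = None"
      using trap[of \<omega> 0 t] st by (simp add: space_P)
    then show ?case by simp
  qed
  then have "(\<integral>\<omega>. ?g (X t \<omega>) \<partial>P None) = (\<integral>\<omega>. 0 \<partial>P None)"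
    using measurable_compose[OF X_measurable_P[OF st(2)] g(1)] by (intro integral_cong_AE) auto
  then have "case_option 0 (trans_op P X t f) y = (\<integral>\<omega>. ?g (X t \<omega>) \<partial>P y)" for y
    by (cases y) (auto simp: trans_op_def)
  then show ?thesis
    using Chapman_Kolmogorov[OF g st, of "Some x"] by (simp add: trans_op_def)
qed

lemma trans_op_bounds:
  assumes f: "f \<in> bounded_nonneg_borel" and B: "\<And>y. f y \<le> B" and t: "t \<ge> 0"
  shows "0 \<le> trans_op P X t f x" "trans_op P X t f x \<le> B"
proof -
  interpret prob_space "P (Some x)" by (rule prob_space_P)
  have nonneg: "0 \<le> case_option 0 f y" and le: "case_option 0 f y \<le> B" for y
    using f B order_trans[of 0 "f undefined" B] by (auto simp: bounded_nonneg_borel_def split: option.split)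
  show "0 \<le> trans_op P X t f x"
    unfolding trans_op_def by (intro integral_nonneg_AE) (simp add: nonneg)
  have "integrable (P (Some x)) (\<lambda>\<omega>. case_option 0 f (X t \<omega>))"
    using f t by (intro integrable_bounded_X)
      (auto simp: bounded_nonneg_borel_def intro: case_option_borel_measurable bounded_case_option)
  then have "trans_op P X t f x \<le> (\<integral>\<omega>. B \<partial>P (Some x))"
    unfolding trans_op_def by (intro integral_mono) (auto simp: le)
  then show "trans_op P X t f x \<le> B"
    by (simp add: prob_space)
qed

text \<open>
  The restriction to \<open>A \<subseteq> {0..}\<close> removes the negative times, at which the semigroup is arbitrary.
\<close>

lemma discounted_trans_op_measurable:
  assumes f: "f \<in> bounded_nonneg_borel" and A: "A \<in> sets borel" "A \<subseteq> {0..}"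
  shows "(\<lambda>z. ennreal (exp (- l * fst z) * trans_op P X (fst z) f (snd z)) * indicator A (fst z))
    \<in> borel_measurable (borel \<Otimes>\<^sub>M borel)"
proof -
  have "(\<lambda>z. ennreal (exp (- l * fst z) * trans_op P X (max 0 (fst z)) f (snd z)) * indicator A (fst z))
      \<in> borel_measurable (borel \<Otimes>\<^sub>M borel)"
    using trans_op_measurable[of f] f A(1) by (auto simp: bounded_nonneg_borel_def)
  also have "(\<lambda>z. ennreal (exp (- l * fst z) * trans_op P X (max 0 (fst z)) f (snd z)) * indicator A (fst z)) =
      (\<lambda>z. ennreal (exp (- l * fst z) * trans_op P X (fst z) f (snd z)) * indicator A (fst z))"
    using A(2) by (auto simp: fun_eq_iff indicator_def subset_eq)
  finally show ?thesis .
qed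

lemma discounted_integrand_measurable:
  assumes "f \<in> bounded_nonneg_borel" "A \<in> sets borel" "A \<subseteq> {0..}"
  shows "(\<lambda>u. ennreal (exp (- l * u) * trans_op P X u f x) * indicator A u) \<in> borel_measurable borel"
  using measurable_compose[OF measurable_Pair2'[of x] discounted_trans_op_measurable[OF assms, of l]]
  by simp

lemma discounted_integral_measurable:
  assumes "f \<in> bounded_nonneg_borel" "A \<in> sets borel" "A \<subseteq> {0..}"
  shows "discounted_integral P X l A f \<in> borel_measurable borel"
proof -
  have "(\<lambda>z. ennreal (exp (- l * snd z) * trans_op P X (snd z) f (fst z)) * indicator A (snd z))
    \<in> borel_measurable (borel \<Otimes>\<^sub>M lborel)"
    using measurable_compose[OF measurable_Pair[OF measurable_snd measurable_fst] discounted_trans_op_measurable[OF assms, of l]]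
    by (simp cong: measurable_cong_sets)
  then have "(\<lambda>x. \<integral>\<^sup>+u. ennreal (exp (- l * u) * trans_op P X u f x) * indicator A u \<partial>lborel) \<in> borel_measurable borel"
    by (intro lborel.borel_measurable_nn_integral) (simp add: case_prod_unfold)
  then show ?thesis
    by (simp add: discounted_integral_def[abs_def])
qed

lemma discounted_integral_le:
  assumes f: "f \<in> bounded_nonneg_borel" and B: "\<And>y. f y \<le> B" and A: "A \<in> sets borel" "A \<subseteq> {0..}"
    and l: "l > 0"
  shows "discounted_integral P X l A f x \<le> ennreal B * emeasure lborel A"
proof -
  have "discounted_integral P X l A f x \<le> (\<integral>\<^sup>+u. ennreal B * indicator A u \<partial>lborel)"
    unfolding discounted_integral_def
  proof (intro nn_integral_mono)
    fix u
    show "ennreal (exp (- l * u) * trans_op P X u f x) * indicator A u \<le> ennreal B * indicator A u"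
    proof (cases "u \<in> A")
      case True
      then have "u \<ge> 0" using A(2) by auto
      then have "exp (- l * u) * trans_op P X u f x \<le> 1 * B"
        using trans_op_bounds[OF f B, of u x] l by (intro mult_mono) auto
      with True show ?thesis by (simp add: ennreal_leI)
    qed simp
  qed
  also have "\<dots> = ennreal B * emeasure lborel A"
    using A(1) by (simp add: nn_integral_cmult_indicator)
  finally show ?thesis .
qed

text \<open>
  The real integral in \<^const>\<open>resolvent_op\<close> is \<open>0\<close> by default when the integrand fails to be
  integrable; measurability in time and the bound \<open>B e\<^bsup>-\<lambda>u\<^esup>\<close> exclude this.
\<close>

lemma resolvent_op_eq_discounted_integral:
  assumes f: "f \<in> bounded_nonneg_borel" and l: "l > 0"
  shows "ennreal (resolvent_op P X l f x) = discounted_integral P X l {0..} f x"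
proof -
  obtain B where B: "\<And>y. f y \<le> B"
    using f by (auto simp: bounded_nonneg_borel_def bounded_iff abs_le_iff)
  let ?h = "\<lambda>u. indicator {0..} u * (exp (- l * u) * trans_op P X u f x)"
  have eq: "ennreal (?h u) = ennreal (exp (- l * u) * trans_op P X u f x) * indicator {0..} u" for u
    by (simp add: indicator_def)
  have nonneg: "0 \<le> ?h u" for u
    using trans_op_bounds(1)[OF f B, of u x] by (simp add: indicator_def)
  have "(\<lambda>u. ennreal (?h u)) \<in> borel_measurable borel"
    unfolding eq by (rule discounted_integrand_measurable[OF f]) auto
  then have m: "?h \<in> borel_measurable lborel"
    using nonneg borel_measurable_enn2real[of "\<lambda>u. ennreal (?h u)" borel] by (simp cong: measurable_cong_sets)
  have "integrable lborel ?h"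
  proof (rule Bochner_Integration.integrable_bound[OF _ m])
    show "integrable lborel (\<lambda>u. B * (indicator {0<..} u * exp (- (u * l))))"
      using integrable_I0i_exp_mscale[OF l] unfolding set_integrable_def
      by (intro integrable_mult_right) simp
    \<comment> \<open>The dominating function lives on the open half-line, hence the exceptional time \<open>0\<close>.\<close>
    show "AE u in lborel. norm (?h u) \<le> norm (B * (indicator {0<..} u * exp (- (u * l))))"
      using AE_lborel_singleton[of "0::real"]
    proof eventually_elim
      case (elim u)
      show ?case
      proof (cases "u > 0")
        case True
        then show ?thesis
          using trans_op_bounds[OF f B, of u x]
          by (auto simp: abs_mult mult.commute intro!: mult_right_mono)
      qed (use elim in \<open>simp add: indicator_def\<close>)
    qed
  qed
  then have "(\<integral>\<^sup>+u. ennreal (?h u) \<partial>lborel) = ennreal (\<integral>u. ?h u \<partial>lborel)"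
    using nonneg by (intro nn_integral_eq_integral) auto
  then show ?thesis
    unfolding eq by (simp add: resolvent_op_def discounted_integral_def set_lebesgue_integral_def)
qed

lemma discounted_integral_split:
  assumes f: "f \<in> bounded_nonneg_borel" and t: "t \<ge> 0"
  shows "discounted_integral P X l {0..} f x =
    discounted_integral P X l {0..<t} f x + discounted_integral P X l {t..} f x"
proof -
  have "discounted_integral P X l {0..} f x = (\<integral>\<^sup>+u.
      ennreal (exp (- l * u) * trans_op P X u f x) * indicator {0..<t} u +
      ennreal (exp (- l * u) * trans_op P X u f x) * indicator {t..} u \<partial>lborel)"
    unfolding discounted_integral_def using t by (intro nn_integral_cong) (auto simp: indicator_def)
  also have "\<dots> = discounted_integral P X l {0..<t} f x + discounted_integral P X l {t..} f x"
    unfolding discounted_integral_def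
    using discounted_integrand_measurable[OF f, of "{0..<t}"] discounted_integrand_measurable[OF f, of "{t..}"] t
    by (subst nn_integral_add) (simp_all add: subset_eq)
  finally show ?thesis .
qed

text \<open>Substitute \<open>u = t + s\<close> and apply the semigroup law.\<close>

lemma discounted_integral_trans_op:
  assumes f: "f \<in> bounded_nonneg_borel" and t: "t \<ge> 0"
  shows "discounted_integral P X l {0..} (trans_op P X t f) x =
    ennreal (exp (l * t)) * discounted_integral P X l {t..} f x"
proof -
  have m: "(\<lambda>u. ennreal (exp (- l * u) * trans_op P X u f x) * indicator {t..} u) \<in> borel_measurable borel"
    using t by (intro discounted_integrand_measurable[OF f]) auto
  have "ennreal (exp (l * t)) * discounted_integral P X l {t..} f x =
    ennreal (exp (l * t)) * (\<integral>\<^sup>+s. ennreal (exp (- l * (t + 1 * s)) * trans_op P X (t + 1 * s) f x) * indicator {t..} (t + 1 * s) \<partial>lborel)"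
    unfolding discounted_integral_def by (subst nn_integral_real_affine[OF m, of 1 t]) auto
  also have "\<dots> = (\<integral>\<^sup>+s. ennreal (exp (l * t)) * (ennreal (exp (- l * (t + 1 * s)) * trans_op P X (t + 1 * s) f x) * indicator {t..} (t + 1 * s)) \<partial>lborel)"
    by (intro nn_integral_cmult[symmetric] measurable_compose[OF _ m, of "\<lambda>s. t + 1 * s" lborel]) simp
  also have "\<dots> = discounted_integral P X l {0..} (trans_op P X t f) x"
    unfolding discounted_integral_def
  proof (intro nn_integral_cong)
    fix s
    show "ennreal (exp (l * t)) * (ennreal (exp (- l * (t + 1 * s)) * trans_op P X (t + 1 * s) f x) * indicator {t..} (t + 1 * s))
      = ennreal (exp (- l * s) * trans_op P X s (trans_op P X t f) x) * indicator {0..} s"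
    proof (cases "s \<ge> 0")
      case True
      have "exp (l * t) * (exp (- l * (t + s)) * trans_op P X (t + s) f x) = exp (- l * s) * trans_op P X (t + s) f x"
        by (simp add: exp_add[symmetric] mult.assoc[symmetric] ring_distribs del: exp_add)
      then show ?thesis
        using True by (simp only: trans_op_semigroup[OF f True t] add.commute[of s t] ennreal_mult'[OF exp_ge_zero, symmetric] mult.assoc[symmetric] mult_1) (simp add: indicator_def)
    qed simp
  qed
  finally show ?thesis ..
qed

lemma resolvent_op_shift:
  assumes f: "f \<in> bounded_nonneg_borel" and Pf: "trans_op P X t f \<in> bounded_nonneg_borel"
    and t: "t \<ge> 0" and l: "l > 0"
  shows "ennreal (exp (l * t)) * ennreal (resolvent_op P X l f x) =
    ennreal (exp (l * t)) * discounted_integral P X l {0..<t} f x + ennreal (resolvent_op P X l (trans_op P X t f) x)"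
  unfolding resolvent_op_eq_discounted_integral[OF f l] resolvent_op_eq_discounted_integral[OF Pf l]
    discounted_integral_trans_op[OF f t] discounted_integral_split[OF f t]
  by (rule distrib_left)

section \<open>Passage to the limit\<close>

text \<open>
  Integrate \<open>resolvent_op_shift\<close> against \<open>\<alpha>\<^sub>\<lambda>\<close>. The window term is at most
  \<open>e\<^bsup>\<lambda>t\<^esup> B t\<close> times the mass of \<open>\<alpha>\<^sub>\<lambda>\<close>, so both sides of the identity converge, to \<open>a\<close> and to
  \<open>0 + b\<close>.
\<close>

lemma limit_measure_trans_op:
  assumes f: "f \<in> bounded_nonneg_borel" and Pf: "trans_op P X t f \<in> bounded_nonneg_borel" and t: "t \<ge> 0"
    and \<alpha>: "\<And>l. l > 0 \<Longrightarrow> sets (\<alpha> l) = sets borel"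
    and mass: "((\<lambda>l. emeasure (\<alpha> l) (space (\<alpha> l))) \<longlongrightarrow> 0) (at_right 0)"
    and lim_f: "((\<lambda>l. \<integral>\<^sup>+x. ennreal (resolvent_op P X l f x) \<partial>\<alpha> l) \<longlongrightarrow> a) (at_right 0)"
    and lim_Pf: "((\<lambda>l. \<integral>\<^sup>+x. ennreal (resolvent_op P X l (trans_op P X t f) x) \<partial>\<alpha> l) \<longlongrightarrow> b) (at_right 0)"
  shows "b = a"
proof -
  obtain B where B: "\<And>y. f y \<le> B"
    using f by (auto simp: bounded_nonneg_borel_def bounded_iff abs_le_iff)
  let ?e = "\<lambda>l. ennreal (exp (l * t))"
  let ?R = "\<lambda>l. ?e l * (\<integral>\<^sup>+x. discounted_integral P X l {0..<t} f x \<partial>\<alpha> l)"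
  have pos: "eventually (\<lambda>l::real. l > 0) (at_right 0)"
    by (simp add: eventually_at_right_less)
  have m: "(\<lambda>x. discounted_integral P X l A f x) \<in> borel_measurable (\<alpha> l)"
    if "l > 0" "A \<in> sets borel" "A \<subseteq> {0..}" for l A
    using discounted_integral_measurable[OF f that(2,3)] \<alpha>[OF that(1)] by (simp cong: measurable_cong_sets)
  have eq: "?e l * (\<integral>\<^sup>+x. ennreal (resolvent_op P X l f x) \<partial>\<alpha> l) =
      ?R l + (\<integral>\<^sup>+x. ennreal (resolvent_op P X l (trans_op P X t f) x) \<partial>\<alpha> l)" if l: "l > 0" for l
  proof -
    have "(\<lambda>x. ennreal (resolvent_op P X l f x)) \<in> borel_measurable (\<alpha> l)"
      using m[OF l, of "{0..}"] by (simp add: resolvent_op_eq_discounted_integral[OF f l])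
    moreover have "(\<lambda>x. ennreal (resolvent_op P X l (trans_op P X t f) x)) \<in> borel_measurable (\<alpha> l)"
      using m[OF l, of "{t..}"] t
      by (simp add: resolvent_op_eq_discounted_integral[OF Pf l] discounted_integral_trans_op[OF f t])
    moreover have "(\<lambda>x. discounted_integral P X l {0..<t} f x) \<in> borel_measurable (\<alpha> l)"
      by (intro m l) auto
    ultimately show ?thesis
      by (simp add: nn_integral_cmult[symmetric] nn_integral_add[symmetric] resolvent_op_shift[OF f Pf t l])
  qed
  have e: "(?e \<longlongrightarrow> ennreal (exp (0 * t))) (at_right 0)"
    by (intro tendsto_intros)
  have R: "(?R \<longlongrightarrow> 0) (at_right 0)"
  proof (rule tendsto_sandwich[OF _ _ tendsto_const])
    show "eventually (\<lambda>l. 0 \<le> ?R l) (at_right 0)" by simp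
    show "eventually (\<lambda>l. ?R l \<le> ?e l * (ennreal B * ennreal t * emeasure (\<alpha> l) (space (\<alpha> l)))) (at_right 0)"
      using pos
    proof eventually_elim
      case (elim l)
      have "(\<integral>\<^sup>+x. discounted_integral P X l {0..<t} f x \<partial>\<alpha> l) \<le> (\<integral>\<^sup>+x. ennreal B * ennreal t \<partial>\<alpha> l)"
        using discounted_integral_le[OF f B, of "{0..<t}" l] elim t by (intro nn_integral_mono) (simp add: subset_eq)
      then show ?case
        by (intro mult_left_mono) auto
    qed
    have "((\<lambda>l. ?e l * (ennreal B * ennreal t * emeasure (\<alpha> l) (space (\<alpha> l)))) \<longlongrightarrow>
        ennreal (exp (0 * t)) * (ennreal B * ennreal t * 0)) (at_right 0)"
      by (intro tendsto_mult_ennreal e tendsto_const mass) (auto simp: ennreal_mult_eq_top_iff)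
    then show "((\<lambda>l. ?e l * (ennreal B * ennreal t * emeasure (\<alpha> l) (space (\<alpha> l)))) \<longlongrightarrow> 0) (at_right 0)"
      by simp
  qed
  have "((\<lambda>l. ?e l * (\<integral>\<^sup>+x. ennreal (resolvent_op P X l f x) \<partial>\<alpha> l)) \<longlongrightarrow> ennreal (exp (0 * t)) * a) (at_right 0)"
    by (intro tendsto_mult_ennreal e lim_f) auto
  moreover have "((\<lambda>l. ?e l * (\<integral>\<^sup>+x. ennreal (resolvent_op P X l f x) \<partial>\<alpha> l)) \<longlongrightarrow> 0 + b) (at_right 0)"
    using tendsto_add[OF R lim_Pf] by (rule Lim_transform_eventually) (use pos in eventually_elim, simp add: eq)
  ultimately show "b = a"
    using tendsto_unique[of "at_right (0::real)"] by fastforce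
qed

lemma trans_op_indicator:
  assumes B: "B \<in> sets borel" and t: "t \<ge> 0"
  shows "ennreal (trans_op P X t (indicator B) x) =
    emeasure (P (Some x)) {\<omega> \<in> space (P (Some x)). X t \<omega> \<in> Some ` B}"
proof -
  interpret prob_space "P (Some x)" by (rule prob_space_P)
  have eq: "case_option 0 (indicat_real B) = indicator (Some ` B)"
    by (auto simp: fun_eq_iff indicator_def split: option.split)
  have "(indicat_real (Some ` B)) \<in> borel_measurable borel"
    using case_option_borel_measurable[of "indicat_real B" 0] B by (simp add: eq)
  then have S: "Some ` B \<in> sets borel"
    by (simp add: borel_measurable_indicator_iff)
  let ?E = "{\<omega> \<in> space (P (Some x)). X t \<omega> \<in> Some ` B}"
  have E: "?E \<in> events"
    using measurable_sets[OF X_measurable_P[OF t] S] by (simp add: vimage_def Int_def conj_commute)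
  have "trans_op P X t (indicator B) x = (\<integral>\<omega>. indicator ?E \<omega> \<partial>P (Some x))"
    unfolding trans_op_def eq by (intro Bochner_Integration.integral_cong) (auto simp: indicator_def)
  then show ?thesis
    using E by (simp add: emeasure_eq_measure)
qed

end

theorem propositionA1:
  fixes \<G> :: "'w measure"
    and F :: "real \<Rightarrow> 'w measure"
    and X :: "real \<Rightarrow> 'w \<Rightarrow> 'a::topological_space option"
    and \<theta> :: "real \<Rightarrow> 'w \<Rightarrow> 'w"
    and P :: "'a option \<Rightarrow> 'w measure"
    and H :: "('a \<Rightarrow> real) set"
    and chi :: "'a measure"
    and \<alpha> :: "real \<Rightarrow> 'a measure"
  assumes "borel_right_process_with_lifetime \<G> F X \<theta> P"
    and "unkilled P X"
    and "locally_compact_space (euclidean :: 'a topology)"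
    and "separable_space (euclidean :: 'a topology)"
    and "H \<subseteq> bounded_nonneg_borel"
    and "\<And>t f. t \<ge> 0 \<Longrightarrow> f \<in> H \<Longrightarrow> trans_op P X t f \<in> H"
    and "sets chi = sets borel"
    and "emeasure chi (space chi) \<noteq> 0"
    and "\<And>l. l > 0 \<Longrightarrow> sets (\<alpha> l) = sets borel"
    and "\<And>l. l > 0 \<Longrightarrow> finite_measure (\<alpha> l)"
    and "((\<lambda>l. emeasure (\<alpha> l) (space (\<alpha> l))) \<longlongrightarrow> 0) (at_right 0)"
    and "\<And>f. f \<in> H \<Longrightarrow>
      ((\<lambda>l. \<integral>\<^sup>+x. ennreal (resolvent_op P X l f x) \<partial>\<alpha> l) \<longlongrightarrow> (\<integral>\<^sup>+y. ennreal (f y) \<partial>chi)) (at_right 0)"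
  shows "(\<forall>t\<ge>0. \<forall>f\<in>H. (\<integral>\<^sup>+y. ennreal (trans_op P X t f y) \<partial>chi) = (\<integral>\<^sup>+y. ennreal (f y) \<partial>chi)) \<and>
    (H = bounded_nonneg_borel \<and> sigma_finite_measure chi \<longrightarrow> invariant_measure P X chi)"
proof -
  interpret borel_right_process_with_lifetime \<G> F X \<theta> P by fact
  have inv: "(\<integral>\<^sup>+y. ennreal (trans_op P X t f y) \<partial>chi) = (\<integral>\<^sup>+y. ennreal (f y) \<partial>chi)"
    if t: "t \<ge> 0" and f: "f \<in> H" for t f
  proof (rule limit_measure_trans_op[where \<alpha>=\<alpha> and f=f and t=t])
    have Pf: "trans_op P X t f \<in> H"
      using assms(6) t f .
    show "f \<in> bounded_nonneg_borel" "trans_op P X t f \<in> bounded_nonneg_borel"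
      using assms(5) f Pf by auto
    show "((\<lambda>l. \<integral>\<^sup>+x. ennreal (resolvent_op P X l (trans_op P X t f) x) \<partial>\<alpha> l) \<longlongrightarrow>
        (\<integral>\<^sup>+y. ennreal (trans_op P X t f y) \<partial>chi)) (at_right 0)"
      using assms(12) Pf .
  qed (use assms(9,11,12) t f in auto)
  moreover have "invariant_measure P X chi" if H: "H = bounded_nonneg_borel" and "sigma_finite_measure chi"
    unfolding invariant_measure_def
  proof (intro conjI allI impI ballI)
    fix t :: real and B :: "'a set" assume t: "t \<ge> 0" and B: "B \<in> sets borel"
    have "indicat_real B \<in> H"
      using B unfolding H bounded_nonneg_borel_def by (auto intro!: boundedI[of _ 1] simp: indicator_def)
    from inv[OF t this]
    show "(\<integral>\<^sup>+x. emeasure (P (Some x)) {\<omega> \<in> space (P (Some x)). X t \<omega> \<in> Some ` B} \<partial>chi) = emeasure chi B"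
      using B assms(7) by (simp add: trans_op_indicator[OF B t] ennreal_indicator)
  qed fact+
  ultimately show ?thesis by blast
qed

end
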